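(* Let $S$ be a bounded semilattice. Then the graph $G(S)$ is a tree if and only if it is a star graph.
   Context: A bounded semilattice $(S,\cdot,0,1)$ is a commutative semigroup whose operation is idempotent ($x\cdot x=x$ for all $x$), with a neutral element $1$ and an absorbing element $0$; it is partially ordered by $x\le y \iff x\cdot y=x$, so that $0\le x\le 1$. The graph $G(S)$ is the simple graph (possibly infinite) with vertex set $S\setminus\{0,1\}$ in which two vertices $x,y$ are adjacent iff $x\ne y$ and $x\cdot y\neq 0$. A tree is a nonempty undirected graph in which any two vertices are connected by exactly one path. A star graph is a complete bipartite graph one of whose two parts has exactly one element; the other part may be of any size, including empty (so the one-vertex graph counts as a star). *)

theory Defs
  imports "Graph_Theory.Pair_Digraph"
begin

locale bounded_semilattice = semilattice_neutr +
  fixes zero :: 'a  (\<open>\<^bold>0\<close>)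
  assumes absorbing: "\<^bold>0 \<^bold>* x = \<^bold>0"

text \<open>
  A simple undirected graph, possibly infinite, is represented by the set of its ordered pairs of
  adjacent vertices, i.e. as a symmetric loop-free digraph without parallel arcs
  (locale \<open>pair_bidirected_digraph\<close>).
\<close>

definition semilattice_graph :: "('a \<Rightarrow> 'a \<Rightarrow> 'a) \<Rightarrow> 'a \<Rightarrow> 'a \<Rightarrow> 'a pair_pre_digraph" where
  "semilattice_graph mul one zero =
     \<lparr>pverts = - {zero, one},
      parcs = {(x, y). x \<in> - {zero, one} \<and> y \<in> - {zero, one} \<and> x \<noteq> y \<and> mul x y \<noteq> zero}\<rparr>"

lemma (in bounded_semilattice) simple_semilattice_graph:
  "pair_bidirected_digraph (semilattice_graph (\<^bold>*) \<^bold>1 \<^bold>0)"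
  by unfold_locales
    (auto simp: semilattice_graph_def symmetric_def commute intro!: symI)

text \<open>
  The library constant \<open>tree\<close> is not usable here: it counts the closed walk \<open>u, v, u\<close> along a single
  undirected edge as a cycle. An \<open>apath\<close> repeats no vertex, and as arcs are determined by their
  ends it is the same thing as a path of the undirected graph; the empty path is the only one
  from a vertex to itself.
\<close>

definition undirected_tree :: "'a pair_pre_digraph \<Rightarrow> bool" where
  "undirected_tree G \<longleftrightarrow>
     pair_bidirected_digraph G \<and> pverts G \<noteq> {} \<and>
     (\<forall>u \<in> pverts G. \<forall>v \<in> pverts G. \<exists>!p. pre_digraph.apath (with_proj G) u p v)"

text \<open>
  The library's \<open>complete_bipartite_digraph\<close> covers finite graphs only, so the parts are given here
  as sets instead of cardinalities. Either part may be empty.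
\<close>

definition complete_bipartite :: "'a set \<Rightarrow> 'a set \<Rightarrow> 'a pair_pre_digraph \<Rightarrow> bool" where
  "complete_bipartite U V G \<longleftrightarrow>
     pverts G = U \<union> V \<and> U \<inter> V = {} \<and> parcs G = U \<times> V \<union> V \<times> U"

definition star_graph :: "'a pair_pre_digraph \<Rightarrow> bool" where
  "star_graph G \<longleftrightarrow> (\<exists>U V. complete_bipartite U V G \<and> card U = 1)"

end

theory Submission
  imports Defs
begin

text \<open>
  In a triangle-free \<open>G(S)\<close> adjacent vertices are comparable, since otherwise their product would
  complete a triangle; and the inner vertex of a path on three vertices lies strictly above both
  ends, since in every other position the ends would have a nonzero product. Hence no path has
  two inner vertices, and if \<open>G(S)\<close> is moreover connected, then the upper end of any edge is
  adjacent to all other vertices.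
\<close>

text \<open>The direct arc and the detour through \<open>y\<close> would be two different apaths
  from \<open>x\<close> to \<open>z\<close>.\<close>

lemma (in pair_wf_digraph) undirected_tree_no_triangle:
  assumes tree: "undirected_tree G"
    and arcs: "(x, y) \<in> parcs G" "(y, z) \<in> parcs G" "(x, z) \<in> parcs G"
    and distinct: "x \<noteq> y" "y \<noteq> z" "x \<noteq> z"
  shows False
proof -
  have "apath x [(x, z)] z" "apath x [(x, y), (y, z)] z"
    using arcs distinct by (auto simp: apath_simps dest: wellformed')
  moreover have "\<exists>!p. apath x p z"
    using tree wellformed'[OF arcs(3)] unfolding undirected_tree_def by blast
  ultimately show False
    by blast
qed

lemma (in pair_wf_digraph) undirected_tree_reachable:
  assumes "undirected_tree G" "u \<in> pverts G" "v \<in> pverts G"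
  shows "u \<rightarrow>\<^sup>*\<^bsub>with_proj G\<^esub> v"
  using assms unfolding undirected_tree_def reachable_apath by blast

text \<open>A second arc would start in \<open>V\<close> and therefore lead back to
  \<open>c\<close>, but an apath repeats no vertex.\<close>

lemma (in pair_wf_digraph) apath_from_star_center:
  assumes star: "complete_bipartite {c} V G" and p: "apath c p v"
  shows "p = (if v = c then [] else [(c, v)])"
proof (cases p)
  case Nil
  with p show ?thesis by (simp add: apath_simps)
next
  case (Cons e es)
  then obtain w where e: "e = (c, w)" "w \<in> V" "w \<noteq> c"
    using p star by (cases e) (auto simp: apath_simps complete_bipartite_def)
  show ?thesis
  proof (cases es)
    case Nil
    with Cons p e show ?thesis by (auto simp: apath_simps)
  next
    case (Cons e' es')
    then have "snd e' = c"
      using \<open>p = e # es\<close> p e star by (auto simp: apath_simps complete_bipartite_def)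
    then have "c \<in> set (pawalk_verts w es)"
      using Cons \<open>p = e # es\<close> p by (auto simp: apath_simps dest: hd_in_awalk_verts)
    then show ?thesis
      using \<open>p = e # es\<close> p e by (auto simp: apath_simps)
  qed
qed

lemma (in pair_bidirected_digraph) star_graph_imp_undirected_tree:
  assumes "star_graph G"
  shows "undirected_tree G"
proof -
  obtain c V where star: "complete_bipartite {c} V G"
    using assms by (auto simp: star_graph_def card_1_singleton_iff)
  then have verts: "pverts G = insert c V" and "c \<notin> V"
    and parcs: "parcs G = {c} \<times> V \<union> V \<times> {c}"
    by (auto simp: complete_bipartite_def)
  have "\<exists>!p. apath u p v" if "u \<in> pverts G" "v \<in> pverts G" for u v
  proof (rule ex_ex1I)
    \<comment> \<open>Joining two apaths at \<open>c\<close> may repeat a vertex, for instance when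
      \<open>u = v\<close>; reachability composes freely and still yields an apath.\<close>
    have "u \<rightarrow>\<^sup>*\<^bsub>with_proj G\<^esub> c" "c \<rightarrow>\<^sup>*\<^bsub>with_proj G\<^esub> v"
      using that verts parcs by (auto intro: adj_in_verts)
    then show "\<exists>p. apath u p v"
      unfolding reachable_apath[symmetric] by (rule reachable_trans)
  next
    fix p q
    assume p: "apath u p v" and q: "apath u q v"
    show "p = q"
    proof (cases "u = c")
      case True
      with p q show ?thesis
        using apath_from_star_center[OF star] by metis
    next
      case False
      \<comment> \<open>From a leaf \<open>u\<close> the first arc can only lead to
        \<open>c\<close>, and the rest is then determined as a path from the center. That rest
        visits \<open>v\<close> but not \<open>u\<close>, so a nonempty path has
        \<open>v \<noteq> u\<close>.\<close>
      have *: "r = [] \<and> v = u \<or> v \<noteq> u \<and> r = (u, c) # (if v = c then [] else [(c, v)])"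
        if r: "apath u r v" for r
      proof (cases r)
        case Nil
        with r show ?thesis by (simp add: apath_simps)
      next
        case (Cons e es)
        with r False parcs have e: "e = (u, c)" and es: "apath c es v"
          and u: "u \<notin> set (pawalk_verts c es)"
          by (cases e; auto simp: apath_simps)+
        from es have "v \<in> set (pawalk_verts c es)"
          by (auto simp: apath_def)
        with u e apath_from_star_center[OF star es] Cons show ?thesis
          by auto
      qed
      from *[OF p] *[OF q] show ?thesis
        by auto
    qed
  qed
  moreover have "pair_bidirected_digraph G" ..
  ultimately show ?thesis
    using verts by (simp add: undirected_tree_def)
qed

context bounded_semilattice
begin

abbreviation G :: "'a pair_pre_digraph" where
  "G \<equiv> semilattice_graph (\<^bold>*) \<^bold>1 \<^bold>0"

sublocale graph: pair_bidirected_digraph G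
  by (rule simple_semilattice_graph)

text \<open>A nonzero product forces both factors to be nonzero, so being a vertex reduces to
  differing from the neutral element.\<close>

lemma arc_semilattice_graph:
  "(x, y) \<in> parcs G \<longleftrightarrow>
     x \<noteq> \<^bold>1 \<and> y \<noteq> \<^bold>1 \<and> x \<noteq> y \<and> x \<^bold>* y \<noteq> \<^bold>0"
  by (auto simp: semilattice_graph_def absorbing) (metis absorbing commute)+

lemma mult_eq_one_imp: "x \<^bold>* y = \<^bold>1 \<Longrightarrow> x = \<^bold>1"
  by (metis left_idem right_neutral)

lemma arc_comparable:
  assumes tree: "undirected_tree G" and arc: "(x, y) \<in> parcs G"
  shows "x \<^bold>* y = x \<or> x \<^bold>* y = y"
proof (rule ccontr)
  assume "\<not> ?thesis"
  \<comment> \<open>By idempotence the product of \<open>x\<close> or \<open>y\<close> with their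
    meet is that meet again, hence nonzero. The meet is not the top element because \<open>x\<close>
    is not.\<close>
  moreover from this arc have "(x, x \<^bold>* y) \<in> parcs G" "(x \<^bold>* y, y) \<in> parcs G"
    by (auto simp: arc_semilattice_graph dest: mult_eq_one_imp[OF sym])
  moreover have "x \<noteq> y"
    using arc by (simp add: arc_semilattice_graph)
  ultimately show False
    using graph.undirected_tree_no_triangle[OF tree _ _ arc] by metis
qed

lemma inner_vertex_above:
  assumes tree: "undirected_tree G"
    and arcs: "(x, y) \<in> parcs G" "(y, w) \<in> parcs G" and "x \<noteq> w"
  shows "x \<^bold>* y = x"
proof (rule ccontr)
  assume "x \<^bold>* y \<noteq> x"
  then have xy: "x \<^bold>* y = y"
    using arc_comparable[OF tree arcs(1)] by auto
  \<comment> \<open>As \<open>y\<close> lies below \<open>x\<close>, the product of \<open>y\<close>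
    and \<open>w\<close> lies below that of \<open>x\<close> and \<open>w\<close>.\<close>
  have "x \<^bold>* w \<noteq> \<^bold>0"
  proof
    assume "x \<^bold>* w = \<^bold>0"
    then have "y \<^bold>* w = \<^bold>0"
      by (metis xy absorbing assoc commute)
    with arcs show False
      by (simp add: arc_semilattice_graph)
  qed
  then have "(x, w) \<in> parcs G"
    using arcs \<open>x \<noteq> w\<close> by (simp add: arc_semilattice_graph)
  with graph.undirected_tree_no_triangle[OF tree arcs] arcs \<open>x \<noteq> w\<close> show False
    by (simp add: arc_semilattice_graph)
qed

lemma undirected_tree_imp_star_graph:
  assumes tree: "undirected_tree G"
  shows "star_graph G"
proof -
  note above = inner_vertex_above[OF tree]
  \<comment> \<open>The future center is the upper end of some arc, or an arbitrary vertex if there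
    are no arcs.\<close>
  obtain c where c: "c \<in> pverts G"
    and c_above: "parcs G = {} \<or> (\<exists>x. (x, c) \<in> parcs G \<and> x \<^bold>* c = x)"
  proof (cases "parcs G = {}")
    case True
    then show thesis
      using that tree by (auto simp: undirected_tree_def)
  next
    case False
    then obtain x y where "(x, y) \<in> parcs G"
      by auto
    then show thesis
      using that[of x] that[of y] arc_comparable[OF tree] graph.arcs_symmetric commute
      by (metis graph.wellformed'(1))
  qed
  \<comment> \<open>The induction follows a path to \<open>c\<close> backwards from its end, so the
    claim is already known for the successor \<open>w\<close> of \<open>v\<close>.\<close>
  have adj_center: "v = c \<or> (v, c) \<in> parcs G" if "v \<in> pverts G" for v
    using graph.undirected_tree_reachable[OF tree that c]
  proof (induction rule: graph.converse_reachable_induct)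
    case base
    show ?case by simp
  next
    case (step v w)
    then have vw: "(v, w) \<in> parcs G" by simp
    from step.IH show ?case
    proof
      assume wc: "(w, c) \<in> parcs G"
      \<comment> \<open>Otherwise \<open>w\<close> is the inner vertex between \<open>c\<close> and
        \<open>v\<close>, so \<open>c\<close> lies below \<open>w\<close>. Conversely
        \<open>w\<close> lies below \<open>c\<close>: either \<open>w = x\<close>, or
        \<open>c\<close> is the inner vertex between \<open>w\<close> and \<open>x\<close>.
        Antisymmetry then gives \<open>w = c\<close>, although they are joined by an arc.\<close>
      have "v = c"
      proof (rule ccontr)
        assume "v \<noteq> c"
        then have cw: "c \<^bold>* w = c"
          using above[of c w v] vw wc by (auto dest: graph.arcs_symmetric)
        obtain x where x: "(x, c) \<in> parcs G" "x \<^bold>* c = x"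
          using c_above vw by auto
        have "w \<^bold>* c = w"
          using x above[of w c x] wc by (cases "w = x") (auto dest: graph.arcs_symmetric)
        with cw wc show False
          by (metis arc_semilattice_graph commute)
      qed
      then show ?thesis ..
    qed (use vw in simp)
  qed
  define V where "V = pverts G - {c}"
  have adj: "(v, c) \<in> parcs G" "(c, v) \<in> parcs G" if "v \<in> V" for v
    using adj_center[of v] that by (auto simp: V_def dest: graph.arcs_symmetric)
  \<comment> \<open>An arc avoiding \<open>c\<close> would form a triangle with \<open>c\<close>,
    since both of its ends are adjacent to \<open>c\<close>.\<close>
  have "(u, v) \<in> {c} \<times> V \<union> V \<times> {c}" if uv: "(u, v) \<in> parcs G" for u v
  proof (rule ccontr)
    assume "\<not> ?thesis"
    moreover have "u \<in> pverts G" "v \<in> pverts G" "u \<noteq> v"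
      using uv by (auto dest: graph.wellformed' graph.no_loops')
    ultimately have "u \<in> V" "v \<in> V" "u \<noteq> v"
      by (auto simp: V_def)
    then show False
      using graph.undirected_tree_no_triangle[OF tree adj(1) adj(2) uv] by (auto simp: V_def)
  qed
  then have "complete_bipartite {c} V G"
    using c adj by (auto simp: complete_bipartite_def V_def)
  then show ?thesis
    by (auto simp: star_graph_def)
qed

end

theorem theorem2p20:
  fixes mul :: "'a \<Rightarrow> 'a \<Rightarrow> 'a" and one zero :: 'a
  assumes "bounded_semilattice mul one zero"
  shows "undirected_tree (semilattice_graph mul one zero) \<longleftrightarrow>
         star_graph (semilattice_graph mul one zero)"
proof -
  interpret bounded_semilattice mul one zero
    by (rule assms)
  show ?thesis
    using undirected_tree_imp_star_graph graph.star_graph_imp_undirected_tree by blast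
qed

end
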